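(* Let $\{L_n^{(\alpha)}(x)\}_{n=0}^\infty$ be a sequence of Laguerre polynomials with $\alpha > -1$. Assume that $\alpha$ and $n \in \mathbb{N}$ are such that $L_{n+1}^{(\alpha+2)}(x)$ and $L_n^{(\alpha)}(x)$ have no common zeros. If $\{w_i\}_{i=1}^{n+1}$ are the zeros of $L_{n+1}^{(\alpha+2)}(x)$ in increasing order, then each of the $n+1$ intervals $(0,w_1), (w_1,w_2), \dots, (w_n,w_{n+1})$ contains either the point $n+1+\sqrt{(n+1)(n+\alpha+2)}$ or exactly one (simple) zero of $L_n^{(\alpha)}(x)$, but not both. The zeros of $L_n^{(\alpha)}(x)$ and $L_{n+1}^{(\alpha+2)}(x)$, $\alpha>-1$, are interlacing if and only if the point $n+1+\sqrt{(n+1)(n+\alpha+2)}$ lies in the open interval $(0,w_1)$. This occurs when $\alpha \gg n$.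
   Context: $\mathbb{N}=\{1,2,3,\dots\}$. For $\alpha>-1$ and an integer $n\ge 0$, $L_n^{(\alpha)}(x)=\sum_{k=0}^{n}\binom{n+\alpha}{n-k}\frac{(-x)^k}{k!}$ is the Laguerre polynomial of degree $n$; the sequence $\{L_n^{(\alpha)}\}_{n\ge 0}$ is orthogonal on $(0,\infty)$ with respect to the weight $e^{-x}x^{\alpha}$, and for $n\ge 1$ the polynomial $L_n^{(\alpha)}$ has $n$ real, simple, positive zeros. The zeros of two polynomials $p$ of degree $n$ and $q$ of degree $n+1$, each having only real simple zeros, are said to be interlacing if exactly one zero of $p$ lies strictly between each pair of successive zeros of $q$. The notation $\alpha\gg n$ is informal: $\alpha$ is much larger than $n$ (no explicit threshold is given). *)

theory Defs
  imports Complex_Main "HOL-Computational_Algebra.Polynomial"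
begin

definition laguerre :: "nat \<Rightarrow> real \<Rightarrow> real poly" where
  "laguerre n \<alpha> =
     (\<Sum>k\<le>n. monom (((real n + \<alpha>) gchoose (n - k)) * (-1) ^ k / fact k) k)"

text \<open>"Real" and "simple" refer to all complex zeros of the polynomial.\<close>

definition real_simple_zeros :: "real poly \<Rightarrow> bool" where
  "real_simple_zeros p \<longleftrightarrow>
     rsquarefree (map_poly complex_of_real p) \<and>
     (\<forall>z. poly (map_poly complex_of_real p) z = 0 \<longrightarrow> z \<in> \<real>)"

definition interlacing :: "real poly \<Rightarrow> real poly \<Rightarrow> bool" where
  "interlacing p q \<longleftrightarrow>
     degree q = degree p + 1 \<and> real_simple_zeros p \<and> real_simple_zeros q \<and>
     (\<forall>a b. a < b \<and> poly q a = 0 \<and> poly q b = 0 \<and> (\<forall>y\<in>{a<..<b}. poly q y \<noteq> 0)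
        \<longrightarrow> (\<exists>!x. x \<in> {a<..<b} \<and> poly p x = 0))"

text \<open>\<open>w 1 < \<dots> < w m\<close> are the real zeros of \<open>p\<close>; the other values of \<open>w\<close> are irrelevant.\<close>

definition increasing_zeros :: "real poly \<Rightarrow> nat \<Rightarrow> (nat \<Rightarrow> real) \<Rightarrow> bool" where
  "increasing_zeros p m w \<longleftrightarrow>
     strict_mono_on {1..m} w \<and> w ` {1..m} = {x. poly p x = 0}"

text \<open>The intervals \<open>(0, w 1), (w 1, w 2), (w 2, w 3), \<dots>\<close>, numbered from 1.\<close>

definition zero_gap :: "(nat \<Rightarrow> real) \<Rightarrow> nat \<Rightarrow> real set" where
  "zero_gap w i = {(if i = 1 then 0 else w (i - 1)) <..< w i}"

definition extra_point :: "nat \<Rightarrow> real \<Rightarrow> real" where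
  "extra_point n \<alpha> = real n + 1 + sqrt ((real n + 1) * (real n + \<alpha> + 2))"

end

theory Submission imports Defs
begin

text \<open>
  Let \<open>P = L\<^bsub>n+1\<^esub>\<^bsup>(\<alpha>+2)\<^esup>\<close>, \<open>Q = L\<^bsub>n\<^esub>\<^bsup>(\<alpha>)\<^esup>\<close> and \<open>\<theta> = x d/dx\<close>. Comparing coefficients,
  \<open>K Q = (n + 1 - \<theta>) (\<theta> + \<alpha> + 1) (\<theta> + \<alpha> + 2) P\<close> with a constant \<open>K > 0\<close>, and the differential
  equation of \<open>P\<close> reduces this to \<open>K Q(w) = - q(w) w P'(w)\<close> at the zeros \<open>w\<close> of \<open>P\<close>, where \<open>q\<close> is a
  quadratic whose only positive zero is the extra point. As \<open>P'\<close> changes sign between consecutive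
  zeros of \<open>P\<close>, so does \<open>Q\<close>, unless the extra point lies between them; hence \<open>Q\<close> has a zero in every
  gap not containing the extra point. There are \<open>n + 1\<close> gaps and \<open>Q\<close> has degree \<open>n\<close>, so the
  extra point is in exactly one gap and \<open>Q\<close> has exactly one simple zero in each of the others.
  For large \<open>\<alpha>\<close>, a barrier argument for \<open>x P' / P\<close> shows that the first zero of \<open>P\<close> exceeds
  \<open>(\<alpha> + 1 - n) / 2\<close>, which exceeds the extra point if \<open>\<alpha> \<ge> 20 n\<close>.
\<close>

section \<open>Gaps between zeros and counting of roots\<close>

lemma zero_gap_disjoint:
  assumes mono: "strict_mono_on {1..m} w" and ij: "i \<in> {1..m}" "j \<in> {1..m}"
    and x: "x \<in> zero_gap w i" "x \<in> zero_gap w j"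
  shows "i = j"
proof -
  have False if "k < l" "k \<in> {1..m}" "l \<in> {1..m}" "x \<in> zero_gap w k" "x \<in> zero_gap w l" for k l
  proof -
    have "w k \<le> w (l - 1)"
      using that strict_mono_on_leD[OF mono, of k "l - 1"] by auto
    with that show False by (auto simp: zero_gap_def)
  qed
  with ij x show ?thesis by (metis linorder_neqE_nat)
qed

text \<open>If \<open>r\<close> had order at least 2, one factor \<open>[:- r, 1:]\<close> could be
  divided out without losing a root, leaving more distinct roots than the degree allows.\<close>

lemma order_1_of_card_roots:
  fixes p :: "'a::idom poly"
  assumes p: "p \<noteq> 0" and card: "card {x. poly p x = 0} = degree p" and r: "poly p r = 0"
  shows "order r p = 1"
proof (rule ccontr)
  assume "order r p \<noteq> 1"
  then have "2 \<le> order r p" using p r order_root[of p r] by linarith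
  then obtain s where s: "p = [:- r, 1:] ^ 2 * s"
    using order_divides[of r 2 p] by (auto elim: dvdE)
  let ?t = "[:- r, 1:] * s"
  have t: "p = [:- r, 1:] * ?t" unfolding s power2_eq_square by (rule mult.assoc)
  then have t0: "?t \<noteq> 0" using p by auto
  have "degree p = degree [:- r, 1:] + degree ?t"
    by (subst t, rule degree_mult_eq) (use t0 in auto)
  then have "degree p = Suc (degree ?t)" by simp
  moreover have "{x. poly p x = 0} \<subseteq> {x. poly ?t x = 0}" unfolding s by auto
  then have "card {x. poly p x = 0} \<le> card {x. poly ?t x = 0}"
    using poly_roots_finite[OF t0] by (intro card_mono)
  moreover have "card {x. poly ?t x = 0} \<le> degree ?t" using t0 by (rule card_poly_roots_bound)
  ultimately show False using card by linarith
qed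

text \<open>The real roots embed into the complex ones, of which there are at most
  \<open>degree p\<close>; by counting they are all of them. Simplicity is then
  \<open>order_1_of_card_roots\<close> over the complex numbers.\<close>

lemma real_simple_zeros_of_card_roots:
  assumes p: "p \<noteq> 0" and card: "card {x. poly p x = 0} = degree p"
  shows "real_simple_zeros p"
proof -
  let ?P = "map_poly complex_of_real p"
  have P: "?P \<noteq> 0" using p by (simp add: map_poly_eq_0_iff)
  have deg: "degree ?P = degree p" by (simp add: degree_map_poly)
  have "poly ?P (complex_of_real x) = complex_of_real (poly p x)" for x
    by (induction p) (auto simp: map_poly_pCons)
  then have sub: "complex_of_real ` {x. poly p x = 0} \<subseteq> {z. poly ?P z = 0}" by auto
  have c: "card (complex_of_real ` {x. poly p x = 0}) = degree p"
    using card by (simp add: card_image inj_on_def)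
  have "card {z. poly ?P z = 0} \<le> degree p"
    using card_poly_roots_bound[OF P] deg by simp
  then have eq: "complex_of_real ` {x. poly p x = 0} = {z. poly ?P z = 0}"
    using card_seteq[OF poly_roots_finite[OF P] sub] c by simp
  then have "card {z. poly ?P z = 0} = degree ?P" using c deg by simp
  then have "order z ?P = 1" if "poly ?P z = 0" for z
    using order_1_of_card_roots[OF P] that by blast
  then have "rsquarefree ?P"
    using P order_root[of ?P] unfolding rsquarefree_def by auto
  moreover have "z \<in> \<real>" if "poly ?P z = 0" for z
    using that eq by (metis (mono_tags, lifting) Reals_of_real image_iff mem_Collect_eq)
  ultimately show ?thesis unfolding real_simple_zeros_def by blast
qed

text \<open>One chosen root in each gap without \<open>e\<close> gives distinct roots of
  \<open>p\<close>, so at most \<open>n\<close> gaps avoid \<open>e\<close> and some gap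
  \<open>j\<close> contains it. By disjointness the other \<open>n\<close> gaps avoid
  \<open>e\<close>, and their chosen roots already exhaust the roots of \<open>p\<close>.\<close>

lemma zero_gap_pigeonhole:
  assumes mono: "strict_mono_on {1..n + 1} w" and p: "p \<noteq> 0" "degree p = n"
    and gap: "\<And>i. i \<in> {1..n + 1} \<Longrightarrow> e \<notin> zero_gap w i \<Longrightarrow> \<exists>x\<in>zero_gap w i. poly p x = 0"
  obtains j where "j \<in> {1..n + 1}" "e \<in> zero_gap w j" "\<forall>x\<in>zero_gap w j. poly p x \<noteq> 0"
    "\<And>i. i \<in> {1..n + 1} \<Longrightarrow> i \<noteq> j \<Longrightarrow> e \<notin> zero_gap w i"
    "\<And>i. i \<in> {1..n + 1} \<Longrightarrow> i \<noteq> j \<Longrightarrow> \<exists>!x. x \<in> zero_gap w i \<and> poly p x = 0"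
    "card {x. poly p x = 0} = degree p"
proof -
  define I where "I = {i \<in> {1..n + 1}. e \<notin> zero_gap w i}"
  let ?R = "{x. poly p x = 0}"
  have fR: "finite ?R" using p poly_roots_finite by blast
  have cR: "card ?R \<le> n" using card_poly_roots_bound[OF p(1)] p(2) by simp
  obtain f where f: "\<And>i. i \<in> I \<Longrightarrow> f i \<in> zero_gap w i \<and> poly p (f i) = 0"
    using gap unfolding I_def by (metis (no_types, lifting) mem_Collect_eq)
  have I: "I \<subseteq> {1..n + 1}" unfolding I_def by auto
  have inj: "inj_on f I"
    by (rule inj_onI) (metis f I subsetD zero_gap_disjoint[OF mono])
  have sub: "f ` I \<subseteq> ?R" using f by auto
  have "card I \<le> n" using card_mono[OF fR sub] card_image[OF inj] cR by simp
  then have "I \<noteq> {1..n + 1}" by auto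
  then obtain j where j: "j \<in> {1..n + 1}" "e \<in> zero_gap w j" unfolding I_def by blast
  have Ij: "I = {1..n + 1} - {j}"
    unfolding I_def using j zero_gap_disjoint[OF mono] by blast
  then have "card I = n" using j by simp
  then have c: "card (f ` I) = n" using card_image[OF inj] by simp
  then have eq: "f ` I = ?R" using card_seteq[OF fR sub] cR by simp
  have root: "\<exists>i\<in>I. x = f i" if "poly p x = 0" for x using that eq by blast
  have 1: "\<forall>x\<in>zero_gap w j. poly p x \<noteq> 0"
  proof (intro ballI notI)
    fix x assume x: "x \<in> zero_gap w j" "poly p x = 0"
    then obtain i where "i \<in> I" "x = f i" using root by blast
    then show False using x f zero_gap_disjoint[OF mono, of i j x] j Ij by auto
  qed
  have 2: "e \<notin> zero_gap w i" if "i \<in> {1..n + 1}" "i \<noteq> j" for i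
    using that j zero_gap_disjoint[OF mono] by blast
  have 3: "\<exists>!x. x \<in> zero_gap w i \<and> poly p x = 0" if "i \<in> {1..n + 1}" "i \<noteq> j" for i
  proof (rule ex1I[of _ "f i"])
    have i: "i \<in> I" using that Ij by auto
    show "f i \<in> zero_gap w i \<and> poly p (f i) = 0" using f i by blast
    fix x assume x: "x \<in> zero_gap w i \<and> poly p x = 0"
    then obtain k where k: "k \<in> I" "x = f k" using root by blast
    then have "k = i" using zero_gap_disjoint[OF mono, of k i x] x f[OF k(1)] I i by blast
    then show "x = f i" using k by simp
  qed
  have 4: "card ?R = degree p" using c eq p by simp
  show thesis using that j 1 2 3 4 by blast
qed

section \<open>Signs of a polynomial and its derivative at neighbouring zeros\<close>

lemma pderiv_nonpos_at_zero:
  fixes p :: "real poly"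
  assumes ab: "a < b" "poly p b = 0" and pos: "\<And>x. a < x \<Longrightarrow> x < b \<Longrightarrow> poly p x > 0"
  shows "poly (pderiv p) b \<le> 0"
proof (rule ccontr)
  assume "\<not> ?thesis"
  then obtain d where d: "d > 0" "\<And>h. 0 < h \<Longrightarrow> h < d \<Longrightarrow> poly p (b - h) < poly p b"
    using DERIV_pos_inc_left[OF poly_DERIV, of p b] by fastforce
  define h where "h = min d (b - a) / 2"
  have h: "0 < h" "h < d" "a < b - h"
    unfolding h_def using d(1) ab by (auto simp: min_def field_simps)
  then show False using d(2)[of h] pos[of "b - h"] ab by auto
qed

lemma pderiv_nonneg_at_zero:
  fixes p :: "real poly"
  assumes ab: "a < b" "poly p a = 0" and pos: "\<And>x. a < x \<Longrightarrow> x < b \<Longrightarrow> poly p x > 0"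
  shows "poly (pderiv p) a \<ge> 0"
proof (rule ccontr)
  assume "\<not> ?thesis"
  then obtain d where d: "d > 0" "\<And>h. 0 < h \<Longrightarrow> h < d \<Longrightarrow> poly p a > poly p (a + h)"
    using DERIV_neg_dec_right[OF poly_DERIV, of p a] by fastforce
  define h where "h = min d (b - a) / 2"
  have h: "0 < h" "h < d" "a + h < b"
    unfolding h_def using d(1) ab by (auto simp: min_def field_simps)
  then show False using d(2)[of h] pos[of "a + h"] ab by auto
qed

lemma poly_constant_sign:
  fixes p :: "real poly"
  assumes "\<And>x. a < x \<Longrightarrow> x < b \<Longrightarrow> poly p x \<noteq> 0"
  shows "(\<forall>x. a < x \<and> x < b \<longrightarrow> poly p x > 0) \<or> (\<forall>x. a < x \<and> x < b \<longrightarrow> poly p x < 0)"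
proof (rule ccontr)
  assume "\<not> ?thesis"
  then obtain x y where xy: "a < x" "x < b" "poly p x < 0" "a < y" "y < b" "poly p y > 0"
    using assms by (metis linorder_neqE_linordered_idom)
  then have "x \<noteq> y" by auto
  then obtain z where "min x y < z" "z < max x y" "poly p z = 0"
    using xy poly_IVT_pos[of x y p] poly_IVT_neg[of y x p] by (cases "x < y") (auto simp: min_def max_def)
  moreover from this have "a < z" "z < b" using xy by auto
  ultimately show False using assms by blast
qed

text \<open>\<open>p\<close> keeps one sign on the interval, so its slopes at the two ends cannot
  have the same strict sign. The inequality is weak because an end may be a multiple zero.\<close>

lemma pderiv_consecutive_zeros:
  fixes p :: "real poly"
  assumes ab: "a < b" "poly p a = 0" "poly p b = 0"
    and nz: "\<And>x. a < x \<Longrightarrow> x < b \<Longrightarrow> poly p x \<noteq> 0"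
  shows "poly (pderiv p) a * poly (pderiv p) b \<le> 0"
  using poly_constant_sign[of a b p, OF nz]
proof
  assume "\<forall>x. a < x \<and> x < b \<longrightarrow> poly p x > 0"
  then show ?thesis
    using pderiv_nonneg_at_zero[of a b p] pderiv_nonpos_at_zero[of a b p] ab
    by (auto intro: mult_nonneg_nonpos)
next
  assume "\<forall>x. a < x \<and> x < b \<longrightarrow> poly p x < 0"
  then show ?thesis
    using pderiv_nonneg_at_zero[of a b "- p"] pderiv_nonpos_at_zero[of a b "- p"] ab
    by (auto intro: mult_nonpos_nonneg simp: pderiv_minus)
qed

section \<open>Coefficients of Laguerre polynomials and positivity for
  \<open>x \<le> 0\<close>\<close>

lemma coeff_laguerre:
  "coeff (laguerre n \<alpha>) k = (if k \<le> n then ((real n + \<alpha>) gchoose (n - k)) * (-1) ^ k / fact k else 0)"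
  unfolding laguerre_def by (simp add: coeff_sum coeff_monom if_distrib sum.delta cong: if_cong)

lemma degree_laguerre: "degree (laguerre n \<alpha>) = n"
  by (intro antisym degree_le le_degree) (auto simp: coeff_laguerre)

lemma laguerre_nonzero: "laguerre n \<alpha> \<noteq> 0"
proof -
  have "coeff (laguerre n \<alpha>) n \<noteq> 0" by (simp add: coeff_laguerre)
  then show ?thesis by auto
qed

lemma gbinomial_pos:
  fixes a :: real
  assumes "a > real k - 1"
  shows "a gchoose k > 0"
  unfolding gbinomial_prod_rev using assms by (auto intro!: divide_pos_pos prod_pos)

text \<open>For \<open>x \<le> 0\<close> the alternating signs cancel against those of
  \<open>x ^ k\<close>: no term is negative, and the constant term is positive.\<close>

lemma laguerre_pos:
  assumes "\<alpha> > -1" "x \<le> 0"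
  shows "poly (laguerre n \<alpha>) x > 0"
proof -
  have g: "(real n + \<alpha>) gchoose (n - k) > 0" if "k \<le> n" for k
    using that assms by (intro gbinomial_pos) (auto simp: of_nat_diff)
  have eq: "poly (laguerre n \<alpha>) x = (\<Sum>k\<le>n. ((real n + \<alpha>) gchoose (n - k)) * (- x) ^ k / fact k)"
    unfolding poly_altdef degree_laguerre
    by (intro sum.cong) (auto simp: coeff_laguerre power_minus[of x])
  show ?thesis unfolding eq
  proof (rule sum_pos2[of _ 0])
    show "0 < ((real n + \<alpha>) gchoose (n - 0)) * (- x) ^ 0 / fact 0" using g[of 0] by simp
    show "0 \<le> ((real n + \<alpha>) gchoose (n - k)) * (- x) ^ k / fact k" if "k \<in> {..n}" for k
      using g[of k] that assms by auto
  qed auto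
qed

section \<open>The operator \<theta>, the differential equation and the relation between
  \<open>P\<close> and \<open>Q\<close>\<close>

text \<open>This is \<theta>. It is diagonal on monomials, so a polynomial in \<theta> multiplies
  each coefficient by a scalar and identities can be checked coefficientwise.\<close>

definition euler :: "real poly \<Rightarrow> real poly" where
  "euler p = [:0, 1:] * pderiv p"

lemma coeff_euler: "coeff (euler p) k = real k * coeff p k"
  unfolding euler_def by (cases k) (auto simp: coeff_pderiv)

lemma coeff_X_mult:
  fixes p :: "'a::comm_ring_1 poly"
  shows "coeff ([:0, 1:] * p) k = (if k = 0 then 0 else coeff p (k - 1))"
  by (cases k) simp_all

text \<open>The Laguerre differential equation read off at a single power of \<open>x\<close>; it
  follows from the ratio of neighbouring binomial coefficients.\<close>

lemma coeff_laguerre_Suc: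
  "real (Suc k) * (real (Suc k) + \<alpha>) * coeff (laguerre n \<alpha>) (Suc k) = (real k - real n) * coeff (laguerre n \<alpha>) k"
proof (cases "Suc k \<le> n")
  case True
  define j where "j = n - Suc k"
  have n: "n = Suc k + j" using True j_def by simp
  let ?a = "real n + \<alpha>"
  have "(?a gchoose Suc j) * real (Suc j) = (?a gchoose j) * (?a - real j)"
    using gbinomial_mult_1[of ?a j] by (simp add: algebra_simps)
  moreover have "n - k = Suc j" "n - Suc k = j" "?a - real j = real (Suc k) + \<alpha>" "real n - real k = real (Suc j)"
    using n by auto
  ultimately have "(real (Suc k) + \<alpha>) * (?a gchoose (n - Suc k)) = (real n - real k) * (?a gchoose (n - k))"
    by (simp add: mult.commute)
  moreover have "real (Suc k) * (b * (c * (-1) ^ Suc k / fact (Suc k))) = - (b * c) * ((-1) ^ k / fact k)"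
    for b c :: real
    by (simp add: divide_simps)
  moreover have "- ((real n - real k) * c) * u = (real k - real n) * (c * u)" for c u :: real
    by (simp add: algebra_simps)
  ultimately show ?thesis using True
    by (simp only: coeff_laguerre mult.assoc if_True Suc_leD times_divide_eq_right [symmetric])
next
  case False
  then show ?thesis by (auto simp: coeff_laguerre not_less_eq_eq le_antisym)
qed

text \<open>The equation \<open>x L'' + (\<alpha> + 1 - x) L' + n L = 0\<close>, multiplied by
  \<open>x\<close> and written in terms of \<theta>.\<close>

lemma euler_laguerre:
  "euler (euler (laguerre n \<alpha>)) =
     [:- \<alpha>, 1:] * euler (laguerre n \<alpha>) - smult (real n) ([:0, 1:] * laguerre n \<alpha>)"
proof (rule poly_eqI)
  fix k
  let ?L = "laguerre n \<alpha>"
  have "[:- \<alpha>, 1:] * euler ?L = [:0, 1:] * euler ?L - smult \<alpha> (euler ?L)" by simp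
  then show "coeff (euler (euler ?L)) k =
      coeff ([:- \<alpha>, 1:] * euler ?L - smult (real n) ([:0, 1:] * ?L)) k"
    using coeff_laguerre_Suc[of "k - 1" \<alpha> n]
    by (cases k) (simp_all add: coeff_X_mult coeff_euler algebra_simps)
qed

lemma poly_euler: "poly (euler p) x = x * poly (pderiv p) x"
  by (simp add: euler_def)

lemma euler_mult: "euler (p * q) = euler p * q + p * euler q"
  by (simp only: euler_def pderiv_mult) (simp only: algebra_simps)

text \<open>Two absorptions lower the upper index alone and a third lowers both indices. With
  \<open>a = n + \<alpha> + 3\<close> and \<open>j = n + 1 - k\<close> this leads from the
  coefficients of \<open>P\<close> to those of \<open>Q\<close>.\<close>

lemma gbinomial_absorb3:
  fixes a :: real
  assumes "j > 0"
  shows "real j * (a - 1 - real j) * (a - real j) * (a gchoose j) =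
    a * (a - 1) * (a - 2) * ((a - 3) gchoose (j - 1))"
proof -
  have 1: "(a - real j) * (a gchoose j) = a * ((a - 1) gchoose j)"
    by (rule gbinomial_absorb_comp)
  have 2: "(a - 1 - real j) * ((a - 1) gchoose j) = (a - 1) * ((a - 2) gchoose j)"
    using gbinomial_absorb_comp[of "a - 1" j] by simp
  have 3: "real j * ((a - 2) gchoose j) = (a - 2) * ((a - 3) gchoose (j - 1))"
    using gbinomial_absorption[of "j - 1" "a - 2"] assms by simp
  show ?thesis using 1 2 3 by algebra
qed

text \<open>\<open>T\<close> is \<open>(\<theta> + \<alpha> + 1) (\<theta> + \<alpha> + 2) P\<close>
  multiplied out. The remaining factor \<open>n + 1 - \<theta>\<close> removes the top coefficient,
  lowering the degree to that of \<open>Q\<close>.\<close>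

lemma laguerre_euler_shift:
  fixes n :: nat and \<alpha> :: real
  defines "P \<equiv> laguerre (n + 1) (\<alpha> + 2)"
  defines "T \<equiv> euler (euler P) + smult (2 * \<alpha> + 3) (euler P) + smult ((\<alpha> + 2) * (\<alpha> + 1)) P"
  shows "smult ((real n + \<alpha> + 3) * (real n + \<alpha> + 2) * (real n + \<alpha> + 1)) (laguerre n \<alpha>) =
    smult (real n + 1) T - euler T"
proof (rule poly_eqI)
  fix k
  have T: "coeff (smult (real n + 1) T - euler T) k =
      (real n + 1 - real k) * (real k + \<alpha> + 1) * (real k + \<alpha> + 2) * coeff P k"
    unfolding T_def by (simp add: coeff_euler algebra_simps)
  consider "k \<le> n" | "k = n + 1" | "k > n + 1" by linarith
  then show "coeff (smult ((real n + \<alpha> + 3) * (real n + \<alpha> + 2) * (real n + \<alpha> + 1)) (laguerre n \<alpha>)) k =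
      coeff (smult (real n + 1) T - euler T) k"
  proof cases
    case 1
    have "real (n + 1 - k) = real n + 1 - real k" using 1 by (simp add: of_nat_diff)
    then have "(real n + 1 - real k) * (real k + \<alpha> + 1) * (real k + \<alpha> + 2) *
        ((real n + \<alpha> + 3) gchoose (n + 1 - k)) =
        (real n + \<alpha> + 3) * (real n + \<alpha> + 2) * (real n + \<alpha> + 1) * ((real n + \<alpha>) gchoose (n - k))"
      using gbinomial_absorb3[of "n + 1 - k" "real n + \<alpha> + 3"] 1
      by (simp add: algebra_simps)
    then show ?thesis unfolding T P_def using 1
      by (simp add: coeff_laguerre add.commute add.left_commute)
  next
    case 2
    then show ?thesis unfolding T by (simp add: coeff_laguerre)
  next
    case 3
    then show ?thesis unfolding T P_def by (simp add: coeff_laguerre)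
  qed
qed

text \<open>The differential equation of \<open>P\<close> eliminates the second and third powers of
  \<theta> from the shift identity. At a zero of \<open>P\<close> only the term with
  \<open>P'\<close> survives.\<close>

lemma laguerre_contiguous:
  fixes n :: nat and \<alpha> x :: real
  defines "P \<equiv> laguerre (n + 1) (\<alpha> + 2)"
  shows "(real n + \<alpha> + 3) * (real n + \<alpha> + 2) * (real n + \<alpha> + 1) * poly (laguerre n \<alpha>) x =
    (real n + 1) * (x\<^sup>2 + (\<alpha> + 1 - real n) * x + (\<alpha> + 2) * (\<alpha> + 1)) * poly P x
    - ((x - (real n + 1))\<^sup>2 - (real n + 1) * (real n + \<alpha> + 2)) * x * poly (pderiv P) x"
proof -
  define m where "m = real n + 1"
  have add: "euler (p + q) = euler p + euler q" "euler (p - q) = euler p - euler q"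
    "euler (smult c p) = smult c (euler p)" for p q c
    by (simp_all add: euler_def pderiv_add pderiv_diff pderiv_smult algebra_simps)
  have lin: "euler [:c, 1:] = [:0, 1:]" for c by (simp add: euler_def pderiv_pCons)
  have ode: "euler (euler P) = [:- (\<alpha> + 2), 1:] * euler P - smult m ([:0, 1:] * P)"
    using euler_laguerre[of "n + 1" "\<alpha> + 2"] unfolding P_def m_def by (simp add: add.commute)
  \<comment> \<open>Apply \<theta> to \<open>ode\<close> by the product rule; \<theta> maps each
    linear factor to \<open>[:0, 1:]\<close>.\<close>
  have ode': "euler (euler (euler P)) = [:0, 1:] * euler P + [:- (\<alpha> + 2), 1:] * euler (euler P)
      - smult m ([:0, 1:] * P + [:0, 1:] * euler P)"
    by (subst ode) (simp only: add euler_mult lin)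
  define p d1 d2 d3 where d: "p = poly P x" "d1 = poly (euler P) x"
    "d2 = poly (euler (euler P)) x" "d3 = poly (euler (euler (euler P))) x"
  have d2: "d2 = (x - \<alpha> - 2) * d1 - m * x * p"
    unfolding d by (subst ode) (simp add: algebra_simps)
  have d3: "d3 = x * d1 + (x - \<alpha> - 2) * d2 - m * (x * p + x * d1)"
    unfolding d by (subst ode') (simp add: algebra_simps)
  have "(real n + \<alpha> + 3) * (real n + \<alpha> + 2) * (real n + \<alpha> + 1) * poly (laguerre n \<alpha>) x =
      m * (d2 + (2 * \<alpha> + 3) * d1 + (\<alpha> + 2) * (\<alpha> + 1) * p)
      - (d3 + (2 * \<alpha> + 3) * d2 + (\<alpha> + 2) * (\<alpha> + 1) * d1)"
    using arg_cong[OF laguerre_euler_shift[of n \<alpha>, folded P_def], of "\<lambda>p. poly p x"]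
    unfolding d m_def by (simp add: add)
  also have "\<dots> = m * (x\<^sup>2 + (\<alpha> + 2 - m) * x + (\<alpha> + 2) * (\<alpha> + 1)) * p
    - ((x - m)\<^sup>2 - m * (m + \<alpha> + 1)) * d1"
    unfolding d3 d2 by algebra
  finally show ?thesis unfolding d poly_euler m_def by (simp add: algebra_simps)
qed

section \<open>The extra point and zeros of \<open>Q\<close> in the gaps of \<open>P\<close>\<close>

lemma extra_point_pos:
  assumes "\<alpha> > -1"
  shows "extra_point n \<alpha> > 0"
  unfolding extra_point_def by (rule add_pos_nonneg) (use assms in auto)

text \<open>The other root of the quadratic is \<open>n + 1 - s\<close>. It is negative, because
  \<open>\<alpha> > -1\<close> makes the product under the square root exceed
  \<open>(n + 1)^2\<close>.\<close>

lemma extra_point_quadratic: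
  fixes n :: nat and \<alpha> x :: real
  assumes "x > 0" "\<alpha> > -1"
  defines "q \<equiv> (x - (real n + 1))\<^sup>2 - (real n + 1) * (real n + \<alpha> + 2)"
  shows "q > 0 \<longleftrightarrow> x > extra_point n \<alpha>" "q < 0 \<longleftrightarrow> x < extra_point n \<alpha>"
proof -
  define s where "s = sqrt ((real n + 1) * (real n + \<alpha> + 2))"
  have s2: "s\<^sup>2 = (real n + 1) * (real n + \<alpha> + 2)" unfolding s_def using assms by simp
  have "(real n + 1)\<^sup>2 < s\<^sup>2" unfolding s2 unfolding power2_eq_square using assms by simp
  then have s: "real n + 1 < s"
    unfolding s_def using assms by (intro real_less_rsqrt) (simp add: s2[unfolded s_def])
  have e: "extra_point n \<alpha> = real n + 1 + s" unfolding extra_point_def s_def by simp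
  have q: "q = (x - extra_point n \<alpha>) * (x - (real n + 1) + s)"
    unfolding q_def s2[symmetric] e by (simp add: power2_eq_square algebra_simps)
  have "x - (real n + 1) + s > 0" using s assms by simp
  then show "q > 0 \<longleftrightarrow> x > extra_point n \<alpha>" "q < 0 \<longleftrightarrow> x < extra_point n \<alpha>"
    unfolding q by (simp_all add: zero_less_mult_iff mult_less_0_iff)
qed

text \<open>As \<open>P\<close> and \<open>Q\<close> share no zero, the key identity shows that
  neither \<open>q\<close> nor \<open>P'\<close> vanishes at a zero of \<open>P\<close>, which makes
  the sign comparisons strict. The option \<open>a = 0\<close> covers the first gap, whose left end
  is not a zero of \<open>P\<close>.\<close>

lemma laguerre_zero_between:
  fixes n :: nat and \<alpha> a b :: real
  defines "P \<equiv> laguerre (n + 1) (\<alpha> + 2)" and "Q \<equiv> laguerre n \<alpha>"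
  assumes \<alpha>: "\<alpha> > -1" and ab: "0 \<le> a" "a < b" "poly P b = 0" "a = 0 \<or> poly P a = 0"
    and nz: "\<And>x. a < x \<Longrightarrow> x < b \<Longrightarrow> poly P x \<noteq> 0"
    and common: "\<nexists>x. poly P x = 0 \<and> poly Q x = 0"
    and e: "\<not> (a < extra_point n \<alpha> \<and> extra_point n \<alpha> < b)"
  shows "\<exists>x\<in>{a<..<b}. poly Q x = 0"
proof -
  define q where "q x = (x - (real n + 1))\<^sup>2 - (real n + 1) * (real n + \<alpha> + 2)" for x
  define K where "K = (real n + \<alpha> + 3) * (real n + \<alpha> + 2) * (real n + \<alpha> + 1)"
  have K: "K > 0" unfolding K_def using \<alpha> by simp
  have key: "K * poly Q x = - (q x * x * poly (pderiv P) x)" if "poly P x = 0" for x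
    using laguerre_contiguous[of n \<alpha> x] that unfolding P_def Q_def K_def q_def by simp
  have nonzero: "q x \<noteq> 0" "poly (pderiv P) x \<noteq> 0" if "poly P x = 0" for x
    using key[OF that] common that K by auto
  have q_sign: "q x > 0 \<longleftrightarrow> x > extra_point n \<alpha>" "q x < 0 \<longleftrightarrow> x < extra_point n \<alpha>" if "x > 0" for x
    unfolding q_def using extra_point_quadratic[OF that \<alpha>] by auto
  have b: "b > 0" using ab by simp
  have epos: "extra_point n \<alpha> > 0"
    using \<alpha> by (rule extra_point_pos)
  have "poly Q a * poly Q b < 0"
  proof (cases "a = 0")
    \<comment> \<open>First gap: \<open>P\<close> descends from \<open>P(0) > 0\<close> to its zero
      \<open>b\<close>, so \<open>P'(b) < 0\<close>. The extra point lies beyond \<open>b\<close>,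
      so \<open>q b < 0\<close>. Hence \<open>Q(b) < 0 < Q(0)\<close>.\<close>
    case True
    have "poly P 0 > 0" unfolding P_def using \<alpha> by (intro laguerre_pos) auto
    then have "\<forall>x. a < x \<and> x < b \<longrightarrow> poly P x > 0"
      using poly_IVT_neg[of 0 _ P] nz True by (metis linorder_neqE_linordered_idom order_less_trans)
    then have "poly (pderiv P) b < 0"
      using pderiv_nonpos_at_zero[of a b P] ab nonzero(2)[of b] by fastforce
    moreover have "q b < 0"
      using e True epos q_sign[OF b] nonzero(1)[OF ab(3)] by (metis linorder_neqE_linordered_idom)
    ultimately have "K * poly Q b < 0"
      unfolding key[OF ab(3)] using b by (simp add: mult_neg_neg mult_neg_pos)
    then have "poly Q b < 0" using K by (simp add: mult_less_0_iff)
    moreover have "poly Q a > 0" unfolding Q_def True using \<alpha> by (intro laguerre_pos) auto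
    ultimately show ?thesis by (rule mult_pos_neg[rotated])
  next
    \<comment> \<open>Inner gap: \<open>P'\<close> changes sign from \<open>a\<close> to
      \<open>b\<close>, while \<open>q\<close> does not, since the extra point lies outside the
      closed interval.\<close>
    case False
    then have a: "a > 0" "poly P a = 0" using ab by auto
    have "poly (pderiv P) a * poly (pderiv P) b < 0"
      using pderiv_consecutive_zeros[of a b P] nz ab a nonzero(2) by (metis mult_eq_0_iff order_less_le)
    moreover have "q a * q b > 0"
      using e ab(2) q_sign[OF a(1)] q_sign[OF b] nonzero(1)[OF a(2)] nonzero(1)[OF ab(3)]
      by (metis linorder_neqE_linordered_idom mult_neg_neg mult_pos_pos order_less_trans)
    ultimately have "(a * b) * (q a * q b) * (poly (pderiv P) a * poly (pderiv P) b) < 0"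
      using a b by (simp add: mult_pos_neg)
    then have "(K * poly Q a) * (K * poly Q b) < 0"
      unfolding key[OF a(2)] key[OF ab(3)] by (simp add: algebra_simps)
    then have "K\<^sup>2 * (poly Q a * poly Q b) < 0" by (simp add: algebra_simps power2_eq_square)
    then show ?thesis using K by (simp add: mult_less_0_iff[of "K\<^sup>2"])
  qed
  then show ?thesis using poly_IVT[OF ab(2), of Q] by force
qed

section \<open>Lower bound for the first zero, and its comparison with the extra point\<close>

text \<open>The Riccati-type barrier \<open>x P' + n P\<close>, multiplied by its integrating factor
  \<open>x\<^bsup>\<beta> - n\<^esup> e\<^bsup>- x\<^esup>\<close>, is nondecreasing as long as \<open>P \<ge> 0\<close> and \<open>x \<le> (\<beta> - n) / 2\<close>.\<close>

lemma laguerre_first_zero_lower_bound: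
  assumes n: "n \<ge> 1" and \<beta>: "\<beta> > -1" and w: "w > 0" "poly (laguerre n \<beta>) w = 0"
    and pos: "\<And>x. 0 < x \<Longrightarrow> x < w \<Longrightarrow> poly (laguerre n \<beta>) x > 0"
  shows "w > (\<beta> - real n) / 2"
proof (rule ccontr)
  assume "\<not> ?thesis"
  then have wle: "w \<le> (\<beta> - real n) / 2" by simp
  define P where "P = laguerre n \<beta>"
  define U where "U = euler P + smult (real n) P"
  define G where "G x = x powr (\<beta> - real n) * exp (- x) * poly U x" for x
  \<comment> \<open>The differential equation turns into a first-order one for the barrier
    \<open>U\<close>, with a source term that is nonnegative while \<open>P \<ge> 0\<close> and
    \<open>x \<le> (\<beta> - n) / 2\<close>.\<close>
  have U: "x * poly (pderiv U) x = (x - \<beta> + real n) * poly U x + real n * (\<beta> - real n - 2 * x) * poly P x" for x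
  proof -
    have "euler U = euler (euler P) + smult (real n) (euler P)"
      unfolding U_def by (simp add: euler_def pderiv_add pderiv_smult algebra_simps)
    then have "poly (euler U) x = poly (euler (euler P)) x + real n * poly (euler P) x" by simp
    also have "poly (euler (euler P)) x = (x - \<beta>) * poly (euler P) x - real n * x * poly P x"
      unfolding P_def by (subst euler_laguerre) (simp add: algebra_simps)
    also have "\<dots> + real n * poly (euler P) x =
        (x - \<beta> + real n) * poly U x + real n * (\<beta> - real n - 2 * x) * poly P x"
      unfolding U_def by (simp add: algebra_simps)
    finally show ?thesis by (simp only: poly_euler)
  qed
  have "poly U 0 > 0" unfolding U_def P_def using n laguerre_pos[OF \<beta>, of 0 n] by (simp add: poly_euler)
  moreover have "(poly U \<longlongrightarrow> poly U 0) (at_right 0)"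
    using poly_isCont[of 0 U] by (simp add: isCont_def filterlim_at_split)
  ultimately have "\<forall>\<^sub>F x in at_right 0. poly U x > 0" by (metis order_tendstoD(1))
  then obtain c where c: "c > 0" "\<And>x. 0 < x \<Longrightarrow> x < c \<Longrightarrow> poly U x > 0"
    unfolding eventually_at_right_field by blast
  \<comment> \<open>The comparison starts at a small positive point where \<open>U > 0\<close>,
    because \<open>G 0 = 0\<close> by the convention \<open>0 powr a = 0\<close>.\<close>
  define \<epsilon> where "\<epsilon> = min c w / 2"
  have \<epsilon>: "0 < \<epsilon>" "\<epsilon> < w" "\<epsilon> < c" unfolding \<epsilon>_def using c(1) w(1) by (auto simp: min_def)
  have "G \<epsilon> \<le> G w"
  proof (rule DERIV_nonneg_imp_nondecreasing[of \<epsilon> w G])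
    show "\<epsilon> \<le> w" using \<epsilon> by simp
    fix x assume x: "\<epsilon> \<le> x" "x \<le> w"
    then have x0: "x > 0" using \<epsilon> by simp
    have P0: "poly P x \<ge> 0"
      using pos[of x] w x x0 unfolding P_def by (cases "x = w") auto
    have "(G has_real_derivative
        x powr (\<beta> - real n - 1) * exp (- x) * ((\<beta> - real n - x) * poly U x + x * poly (pderiv U) x)) (at x)"
    proof -
      have d1: "((\<lambda>x. x powr (\<beta> - real n)) has_real_derivative (\<beta> - real n) * x powr (\<beta> - real n - 1)) (at x)"
        using x0 by (rule has_real_derivative_powr)
      have d2: "((\<lambda>x. exp (- x)) has_real_derivative - exp (- x)) (at x)"
        by (auto intro!: derivative_eq_intros)
      have pw: "x powr (\<beta> - real n) = x * x powr (\<beta> - real n - 1)"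
        using powr_mult_base[of x "\<beta> - real n - 1"] x0 by simp
      show ?thesis unfolding G_def
        by (rule DERIV_cong[OF DERIV_mult[OF DERIV_mult[OF d1 d2] poly_DERIV]]) (simp add: pw algebra_simps)
    qed
    moreover have "(\<beta> - real n - x) * poly U x + x * poly (pderiv U) x =
        real n * (\<beta> - real n - 2 * x) * poly P x"
      unfolding U by (simp add: algebra_simps)
    moreover have "\<dots> \<ge> 0" using P0 x wle by (intro mult_nonneg_nonneg) auto
    ultimately show "\<exists>y. (G has_real_derivative y) (at x) \<and> 0 \<le> y"
      by (metis exp_ge_zero mult_nonneg_nonneg powr_ge_zero)
  qed
  moreover have "G \<epsilon> > 0" unfolding G_def using \<epsilon> c(2) by simp
  ultimately have "G w > 0" by simp
  \<comment> \<open>At \<open>w\<close> the barrier reduces to \<open>w P'(w)\<close>, so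
    \<open>P\<close> would be strictly increasing at a zero that it reaches from above.\<close>
  then have "poly U w > 0" unfolding G_def by (rule zero_less_mult_pos) (use w(1) in simp)
  then have "poly (pderiv P) w > 0"
    unfolding U_def using w by (simp add: poly_euler P_def zero_less_mult_iff)
  moreover have "poly (pderiv P) w \<le> 0"
    using w pos unfolding P_def by (rule pderiv_nonpos_at_zero)
  ultimately show False by simp
qed

lemma extra_point_less:
  assumes n: "n \<ge> 1" and \<alpha>: "\<alpha> \<ge> 20 * real n"
  shows "extra_point n \<alpha> < (\<alpha> + 2 - real (n + 1)) / 2"
proof -
  \<comment> \<open>\<open>?t\<close> is the right-hand side minus \<open>n + 1\<close>, so it must
    exceed the square root.\<close>
  let ?t = "(\<alpha> - 1 - 3 * real n) / 2"
  have n1: "real n \<ge> 1" using n by simp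
  \<comment> \<open>Four times the difference of the squares is
    \<open>\<alpha> (\<alpha> - 10 n - 6) + 5 n^2 - 6 n - 7\<close>. From
    \<open>\<alpha> \<ge> 20 n\<close> the second factor is at least
    \<open>10 n - 6 \<ge> 4\<close>.\<close>
  have "\<alpha> * (\<alpha> - 10 * real n - 6) \<ge> (20 * real n) * 4"
    using n1 \<alpha> by (intro mult_mono) auto
  moreover have "real n * real n \<ge> 0" by simp
  moreover have "real n * 80 \<ge> real n * 6 + 8" using n1 by simp
  ultimately have "(real n + 1) * (real n + \<alpha> + 2) < ?t\<^sup>2"
    using n1 by (simp add: power2_eq_square field_simps; linarith)
  then have "sqrt ((real n + 1) * (real n + \<alpha> + 2)) < ?t"
    using n1 \<alpha> by (intro real_less_lsqrt) auto
  then show ?thesis unfolding extra_point_def by (simp add: field_simps)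
qed

section \<open>Distribution of the zeros, interlacing and large \<alpha>\<close>

lemma increasing_zeros_card:
  assumes "increasing_zeros p m w"
  shows "card {x. poly p x = 0} = m"
proof -
  have "inj_on w {1..m}"
    using assms unfolding increasing_zeros_def by (metis strict_mono_on_imp_inj_on)
  then show ?thesis
    using assms card_image[of w "{1..m}"] unfolding increasing_zeros_def by simp
qed

lemma increasing_zeros_gap:
  assumes w: "increasing_zeros p m w" and i: "i \<in> {1..m}"
    and x: "x \<in> zero_gap w i" "1 < i \<or> (\<forall>y\<le>0. poly p y \<noteq> 0)"
  shows "poly p x \<noteq> 0"
proof
  assume "poly p x = 0"
  then obtain k where k: "k \<in> {1..m}" "x = w k" using w unfolding increasing_zeros_def by blast
  have mono: "strict_mono_on {1..m} w" using w unfolding increasing_zeros_def by blast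
  show False
  proof (cases "k < i")
    case True
    then have "w k \<le> w (i - 1)" using i k strict_mono_on_leD[OF mono, of k "i - 1"] by auto
    then show False using True x k unfolding zero_gap_def by (auto split: if_splits)
  next
    case False
    then have "w i \<le> w k" using i k strict_mono_on_leD[OF mono, of i k] by auto
    then show False using x k unfolding zero_gap_def by auto
  qed
qed

lemma laguerre_zero_pos:
  assumes "\<alpha> > -1" "poly (laguerre n \<alpha>) x = 0"
  shows "x > 0"
  using laguerre_pos[OF assms(1), of x n] assms(2) by fastforce

text \<open>Interlacing concerns only the gaps with two zeros of \<open>P\<close> as ends, that is,
  all but the first. It therefore holds exactly when the one gap without a zero of \<open>Q\<close>
  is the first.\<close>

lemma interlacing_laguerre_iff:
  fixes n :: nat and \<alpha> :: real and w :: "nat \<Rightarrow> real"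
  defines "P \<equiv> laguerre (n + 1) (\<alpha> + 2)" and "Q \<equiv> laguerre n \<alpha>"
  assumes \<alpha>: "\<alpha> > -1"
    and common: "\<nexists>x. poly P x = 0 \<and> poly Q x = 0"
    and w: "increasing_zeros P (n + 1) w"
  shows "\<forall>i\<in>{1..n + 1}.
         (extra_point n \<alpha> \<in> zero_gap w i \<and> (\<forall>x\<in>zero_gap w i. poly Q x \<noteq> 0)) \<or>
         (extra_point n \<alpha> \<notin> zero_gap w i \<and>
            (\<exists>!x. x \<in> zero_gap w i \<and> poly Q x = 0) \<and>
            (\<forall>x\<in>zero_gap w i. poly Q x = 0 \<longrightarrow> order x Q = 1))" (is ?gaps)
    and "interlacing Q P \<longleftrightarrow> extra_point n \<alpha> \<in> {0 <..< w 1}" (is ?inter)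
proof -
  let ?e = "extra_point n \<alpha>"
  have mono: "strict_mono_on {1..n + 1} w" and img: "w ` {1..n + 1} = {x. poly P x = 0}"
    using w unfolding increasing_zeros_def by auto
  have root: "poly P (w i) = 0" if "i \<in> {1..n + 1}" for i using img that by auto
  have Ppos: "x > 0" if "poly P x = 0" for x
    using laguerre_zero_pos[of "\<alpha> + 2" "n + 1" x] that \<alpha> unfolding P_def by simp
  have nz: "poly P x \<noteq> 0" if "i \<in> {1..n + 1}" "x \<in> zero_gap w i" for i x
    using increasing_zeros_gap[OF w that] Ppos by (metis linorder_not_less)
  have ex: "\<exists>x\<in>zero_gap w i. poly Q x = 0" if i: "i \<in> {1..n + 1}" and e: "?e \<notin> zero_gap w i" for i
  proof -
    define a where "a = (if i = 1 then 0 else w (i - 1))"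
    have gap: "zero_gap w i = {a<..<w i}" unfolding zero_gap_def a_def by simp
    have a: "a = 0 \<or> poly P a = 0" "0 \<le> a"
      unfolding a_def using root[of "i - 1"] Ppos[of "w (i - 1)"] i by (cases "i = 1"; force)+
    have "a < w i"
      unfolding a_def using root[OF i] Ppos[of "w i"] i strict_mono_onD[OF mono, of "i - 1" i]
      by (cases "i = 1"; force)
    then show ?thesis unfolding gap Q_def
      using laguerre_zero_between[OF \<alpha>, of a "w i" n] a root[OF i] nz[OF i] common e
      unfolding gap P_def Q_def by auto
  qed
  have Q: "Q \<noteq> 0" "degree Q = n" unfolding Q_def by (rule laguerre_nonzero degree_laguerre)+
  obtain j where j: "j \<in> {1..n + 1}" "?e \<in> zero_gap w j" "\<forall>x\<in>zero_gap w j. poly Q x \<noteq> 0"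
    and notin: "\<And>i. i \<in> {1..n + 1} \<Longrightarrow> i \<noteq> j \<Longrightarrow> ?e \<notin> zero_gap w i"
    and one: "\<And>i. i \<in> {1..n + 1} \<Longrightarrow> i \<noteq> j \<Longrightarrow> \<exists>!x. x \<in> zero_gap w i \<and> poly Q x = 0"
    and card: "card {x. poly Q x = 0} = degree Q"
    by (rule zero_gap_pigeonhole[OF mono Q, of ?e, OF ex]) (assumption | rule that)+
  show ?gaps
    proof
    fix i assume i: "i \<in> {1..n + 1}"
    show "(?e \<in> zero_gap w i \<and> (\<forall>x\<in>zero_gap w i. poly Q x \<noteq> 0)) \<or>
         (?e \<notin> zero_gap w i \<and> (\<exists>!x. x \<in> zero_gap w i \<and> poly Q x = 0) \<and>
            (\<forall>x\<in>zero_gap w i. poly Q x = 0 \<longrightarrow> order x Q = 1))"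
      using j notin[OF i] one[OF i] order_1_of_card_roots[OF Q(1) card] by (cases "i = j") simp_all
  qed
  have gap1: "zero_gap w 1 = {0<..<w 1}" unfolding zero_gap_def by simp
  have gapS: "zero_gap w i = {w (i - 1)<..<w i}" if "i \<noteq> 1" for i using that unfolding zero_gap_def by simp
  have inj1: "?e \<in> {0<..<w 1} \<longleftrightarrow> j = 1"
    using j notin[of 1] gap1 by auto
  show ?inter unfolding inj1
  proof
    assume int: "interlacing Q P"
    show "j = 1"
    proof (rule ccontr)
      \<comment> \<open>Gap \<open>j\<close> then lies between two consecutive zeros of
        \<open>P\<close> but contains no zero of \<open>Q\<close>.\<close>
      assume j1: "j \<noteq> 1"
      have "w (j - 1) < w j" using j j1 strict_mono_onD[OF mono, of "j - 1" j] by force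
      moreover have "poly P (w (j - 1)) = 0" "poly P (w j) = 0"
        using root[of j] root[of "j - 1"] j(1) j1 by force+
      moreover have "\<forall>y\<in>{w (j - 1)<..<w j}. poly P y \<noteq> 0" using nz[OF j(1)] gapS[OF j1] by simp
      ultimately have "\<exists>!x. x \<in> {w (j - 1)<..<w j} \<and> poly Q x = 0"
        using int unfolding interlacing_def by simp
      then obtain x where "x \<in> zero_gap w j" "poly Q x = 0" unfolding gapS[OF j1] by blast
      then show False using j(3) by blast
    qed
  next
    assume j1: "j = 1"
    have P: "P \<noteq> 0" "degree P = n + 1" unfolding P_def by (rule laguerre_nonzero degree_laguerre)+
    have "\<exists>!x. x \<in> {a<..<b} \<and> poly Q x = 0"
      if ab: "a < b" "poly P a = 0" "poly P b = 0" "\<forall>y\<in>{a<..<b}. poly P y \<noteq> 0" for a b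
    proof -
      obtain k l where k: "k \<in> {1..n + 1}" "a = w k" and l: "l \<in> {1..n + 1}" "b = w l"
        using ab img by blast
      have kl: "k < l" using ab(1) k l strict_mono_on_leD[OF mono, of l k] by (meson not_less)
      \<comment> \<open>Consecutive zeros have neighbouring indices, so the interval is gap
        \<open>l\<close> with \<open>l \<ge> 2\<close>, not the exceptional first one.\<close>
      have "k + 1 = l"
      proof (rule ccontr)
        assume "k + 1 \<noteq> l"
        then have "k + 1 < l" using kl by simp
        then have "w (k + 1) \<in> {a<..<b}"
          using k l strict_mono_onD[OF mono, of k "k + 1"] strict_mono_onD[OF mono, of "k + 1" l] by auto
        then show False using ab(4) root[of "k + 1"] k l \<open>k + 1 < l\<close> by auto
      qed
      then have l1: "l \<noteq> 1" "l - 1 = k" using k(1) by auto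
      have "zero_gap w l = {a<..<b}" unfolding gapS[OF l1(1)] l1(2) k(2) l(2) ..
      then show ?thesis using one[OF l(1)] l1(1) j1 by simp
    qed
    moreover have "real_simple_zeros P"
      using P increasing_zeros_card[OF w] by (intro real_simple_zeros_of_card_roots) auto
    moreover have "real_simple_zeros Q" using Q(1) card by (rule real_simple_zeros_of_card_roots)
    ultimately show "interlacing Q P"
      unfolding interlacing_def P(2) Q(2) by blast
  qed
qed

text \<open>For large \<alpha> the absence of common zeros is a consequence: every zero of
  \<open>P\<close> lies beyond the extra point, where \<open>q > 0\<close>, and is simple, so the
  key identity gives \<open>Q\<close> a nonzero value there.\<close>

lemma laguerre_extra_point_first_gap:
  fixes n :: nat and \<alpha> :: real and w :: "nat \<Rightarrow> real"
  defines "P \<equiv> laguerre (n + 1) (\<alpha> + 2)" and "Q \<equiv> laguerre n \<alpha>"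
  assumes n: "n \<ge> 1" and \<alpha>: "\<alpha> \<ge> 20 * real n" and w: "increasing_zeros P (n + 1) w"
  shows "extra_point n \<alpha> \<in> {0 <..< w 1}" and "\<nexists>x. poly P x = 0 \<and> poly Q x = 0"
proof -
  have \<alpha>1: "\<alpha> > -1" using n \<alpha> by linarith
  have mono: "strict_mono_on {1..n + 1} w" and img: "w ` {1..n + 1} = {x. poly P x = 0}"
    using w unfolding increasing_zeros_def by auto
  have P: "P \<noteq> 0" "degree P = n + 1" unfolding P_def by (rule laguerre_nonzero degree_laguerre)+
  have Ppos: "x > 0" if "poly P x = 0" for x
    using laguerre_zero_pos[of "\<alpha> + 2" "n + 1" x] that \<alpha>1 unfolding P_def by simp
  have w1: "poly P (w 1) = 0" using img by auto
  have pos: "poly P x > 0" if x: "0 < x" "x < w 1" for x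
  proof (rule ccontr)
    assume "\<not> poly P x > 0"
    then consider "poly P x = 0" | "poly P x < 0" by linarith
    moreover have "poly P 0 > 0" unfolding P_def using \<alpha>1 by (intro laguerre_pos) auto
    ultimately obtain y where y: "0 < y" "y \<le> x" "poly P y = 0"
      using poly_IVT_neg[OF x(1), of P] x(1) by (meson less_imp_le order_refl)
    moreover have "y \<in> zero_gap w 1" using y x by (simp add: zero_gap_def)
    ultimately show False
      using increasing_zeros_gap[OF w, of 1 y] Ppos by (meson atLeastAtMost_iff le_add2 leD order_refl)
  qed
  have "extra_point n \<alpha> < (\<alpha> + 2 - real (n + 1)) / 2" using n \<alpha> by (rule extra_point_less)
  \<comment> \<open>The barrier bound is applied to \<open>P\<close>, with degree
    \<open>n + 1\<close> and parameter \<open>\<alpha> + 2\<close>.\<close>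
  also have "\<dots> < w 1"
    using laguerre_first_zero_lower_bound[of "n + 1" "\<alpha> + 2" "w 1"] \<alpha>1 w1 Ppos pos unfolding P_def by auto
  finally have less: "extra_point n \<alpha> < w 1" .
  moreover have "extra_point n \<alpha> > 0"
    using \<alpha>1 by (rule extra_point_pos)
  ultimately show "extra_point n \<alpha> \<in> {0 <..< w 1}" by simp
  show "\<nexists>x. poly P x = 0 \<and> poly Q x = 0"
  proof
    assume "\<exists>x. poly P x = 0 \<and> poly Q x = 0"
    then obtain x where x: "poly P x = 0" "poly Q x = 0" by blast
    then obtain i where "i \<in> {1..n + 1}" "x = w i" using img by blast
    then have "x > extra_point n \<alpha>"
      using less strict_mono_on_leD[OF mono, of 1 i] by auto
    then have q: "(x - (real n + 1))\<^sup>2 - (real n + 1) * (real n + \<alpha> + 2) > 0"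
      using extra_point_quadratic(1)[OF Ppos[OF x(1)] \<alpha>1] by blast
    have "rsquarefree P"
      unfolding rsquarefree_def using P order_1_of_card_roots[OF P(1)] increasing_zeros_card[OF w] order_root[of P]
      by metis
    then have "poly (pderiv P) x \<noteq> 0" using x(1) by (auto simp: rsquarefree_roots)
    then show False
      using laguerre_contiguous[of n \<alpha> x] q x Ppos[OF x(1)] unfolding P_def Q_def by auto
  qed
qed

theorem theorem2p2:
  "(\<forall>(n::nat) (\<alpha>::real) (w :: nat \<Rightarrow> real).
      n \<ge> 1 \<and> \<alpha> > -1 \<and>
      (\<nexists>x. poly (laguerre (n + 1) (\<alpha> + 2)) x = 0 \<and> poly (laguerre n \<alpha>) x = 0) \<and>
      increasing_zeros (laguerre (n + 1) (\<alpha> + 2)) (n + 1) w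
      \<longrightarrow>
      (\<forall>i\<in>{1..n + 1}.
         (extra_point n \<alpha> \<in> zero_gap w i \<and>
            (\<forall>x\<in>zero_gap w i. poly (laguerre n \<alpha>) x \<noteq> 0)) \<or>
         (extra_point n \<alpha> \<notin> zero_gap w i \<and>
            (\<exists>!x. x \<in> zero_gap w i \<and> poly (laguerre n \<alpha>) x = 0) \<and>
            (\<forall>x\<in>zero_gap w i. poly (laguerre n \<alpha>) x = 0 \<longrightarrow> order x (laguerre n \<alpha>) = 1))) \<and>
      (interlacing (laguerre n \<alpha>) (laguerre (n + 1) (\<alpha> + 2)) \<longleftrightarrow>
         extra_point n \<alpha> \<in> {0 <..< w 1}))
   \<and>
   (\<exists>C::real. \<forall>(n::nat) (\<alpha>::real) (w :: nat \<Rightarrow> real).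
      n \<ge> 1 \<and> \<alpha> > -1 \<and> \<alpha> \<ge> C * real n \<and>
      increasing_zeros (laguerre (n + 1) (\<alpha> + 2)) (n + 1) w
      \<longrightarrow>
      extra_point n \<alpha> \<in> {0 <..< w 1} \<and>
      interlacing (laguerre n \<alpha>) (laguerre (n + 1) (\<alpha> + 2)))"
proof (rule conjI, goal_cases)
  case 1
  show ?case
  proof (intro allI impI, elim conjE)
    fix n :: nat and \<alpha> :: real and w :: "nat \<Rightarrow> real"
    assume *: "n \<ge> 1" "\<alpha> > -1"
      "\<nexists>x. poly (laguerre (n + 1) (\<alpha> + 2)) x = 0 \<and> poly (laguerre n \<alpha>) x = 0"
      "increasing_zeros (laguerre (n + 1) (\<alpha> + 2)) (n + 1) w"
    show "(\<forall>i\<in>{1..n + 1}.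
         (extra_point n \<alpha> \<in> zero_gap w i \<and>
            (\<forall>x\<in>zero_gap w i. poly (laguerre n \<alpha>) x \<noteq> 0)) \<or>
         (extra_point n \<alpha> \<notin> zero_gap w i \<and>
            (\<exists>!x. x \<in> zero_gap w i \<and> poly (laguerre n \<alpha>) x = 0) \<and>
            (\<forall>x\<in>zero_gap w i. poly (laguerre n \<alpha>) x = 0 \<longrightarrow> order x (laguerre n \<alpha>) = 1))) \<and>
      (interlacing (laguerre n \<alpha>) (laguerre (n + 1) (\<alpha> + 2)) \<longleftrightarrow>
         extra_point n \<alpha> \<in> {0 <..< w 1})"
      by (intro conjI) (rule interlacing_laguerre_iff[OF *(2-4)])+
  qed
next
  case 2
  show ?case
  \<comment> \<open>\<open>\<alpha>\<close> being much larger than \<open>n\<close> is made precise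
    as \<open>\<alpha> \<ge> C n\<close>; 20 is the constant of
    \<open>extra_point_less\<close>.\<close>
  proof (rule exI[of _ 20], intro allI impI, elim conjE)
    fix n :: nat and \<alpha> :: real and w :: "nat \<Rightarrow> real"
    assume *: "n \<ge> 1" "\<alpha> > -1" "\<alpha> \<ge> 20 * real n"
      "increasing_zeros (laguerre (n + 1) (\<alpha> + 2)) (n + 1) w"
    have "extra_point n \<alpha> \<in> {0 <..< w 1}"
      using *(1,3,4) by (rule laguerre_extra_point_first_gap)
    moreover have "\<nexists>x. poly (laguerre (n + 1) (\<alpha> + 2)) x = 0 \<and> poly (laguerre n \<alpha>) x = 0"
      using *(1,3,4) by (rule laguerre_extra_point_first_gap)
    ultimately show "extra_point n \<alpha> \<in> {0 <..< w 1} \<and>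
        interlacing (laguerre n \<alpha>) (laguerre (n + 1) (\<alpha> + 2))"
      using interlacing_laguerre_iff(2)[OF *(2) _ *(4)] by blast
  qed
qed

end
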